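(* Let $\mathscr{E}=\{\eta_i,\rho_i\}_{i=1}^n$ be a multipartite quantum state ensemble on $\mathscr{H}=\bigotimes_{k=1}^m\mathbb{C}^{d_k}$, let $\rho_0=\sum_{i=1}^n\eta_i\rho_i$, let $q\in\mathbb{R}$ and $j\in\{1,\ldots,n\}$. Then $$\mathcal{Q}_j(\mathscr{E})\leqslant q<\mathcal{C}_j(\mathscr{E})$$ if and only if $q\rho_0-\eta_j\rho_j$ is an entanglement witness.
   Context: Let $\mathscr{H}=\bigotimes_{k=1}^m\mathbb{C}^{d_k}$ with $m\geqslant 2$ and positive integers $d_1,\ldots,d_m$. $\mathbb{H}$ is the set of Hermitian operators on $\mathscr{H}$, and $\mathbb{H}_+\subseteq\mathbb{H}$ is the set of positive-semidefinite ones. A state is $\rho\in\mathbb{H}_+$ with $\operatorname{Tr}\rho=1$. An ensemble $\{\eta_i,\rho_i\}_{i=1}^n$ consists of states $\rho_i$ with nonzero probabilities $\eta_i$ (so $\eta_i>0$, $\sum_i\eta_i=1$). An operator $E\in\mathbb{H}_+$ is separable if $E=\sum_l p_l\bigotimes_{k=1}^m\sigma_l^{(k)}$ with $p_l\geqslant 0$ and $\sigma_l^{(k)}$ states on $\mathbb{C}^{d_k}$; $\mathbb{SEP}$ is the set of all separable operators. An operator $E\in\mathbb{H}$ is block positive if $\operatorname{Tr}(EF)\geqslant0$ for all $F\in\mathbb{SEP}$; $\mathbb{SEP}^*$ is the set of all block-positive operators. An entanglement witness is an element of $\mathbb{SEP}^*\setminus\mathbb{H}_+$. A measurement is a family $\mathscr{M}=\{M_i\}_{i=0}^n\subseteq\mathbb{H}_+$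 with $\sum_iM_i=\mathbb{1}$. The maximum confidence to identify $\rho_j$ is $$\mathcal{C}_j(\mathscr{E})=\max_{\mathscr{M}:\,\operatorname{Tr}(\rho_0M_j)\neq0}\frac{\eta_j\operatorname{Tr}(\rho_jM_j)}{\operatorname{Tr}(\rho_0M_j)},$$ the maximum being over all measurements with $\operatorname{Tr}(\rho_0M_j)\neq0$. $\mathcal{Q}_j(\mathscr{E})=\min\{q\in\mathbb{R}\mid q\rho_0-\eta_j\rho_j\in\mathbb{SEP}^*\}$. *)

theory Defs
  imports "Jordan_Normal_Form.Schur_Decomposition"
begin

definition hermitian_ops :: "nat \<Rightarrow> complex mat set" where
  "hermitian_ops N = {A \<in> carrier_mat N N. mat_adjoint A = A}"

(* The order is that of HOL-Library.Complex_Order, so 0 \<le> z says that z is real and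
   nonnegative; (A *v v) \<bullet>c v is the quadratic form of A at v. *)
definition psd_ops :: "nat \<Rightarrow> complex mat set" where
  "psd_ops N = {A \<in> hermitian_ops N. \<forall>v \<in> carrier_vec N. 0 \<le> (A *\<^sub>v v) \<bullet>c v}"

definition mat_trace :: "complex mat \<Rightarrow> complex" where
  "mat_trace A = (\<Sum>i<dim_row A. A $$ (i, i))"

definition states :: "nat \<Rightarrow> complex mat set" where
  "states N = {\<rho> \<in> psd_ops N. mat_trace \<rho> = 1}"

definition mat_sum :: "nat \<Rightarrow> (nat \<Rightarrow> complex mat) \<Rightarrow> nat set \<Rightarrow> complex mat" where
  "mat_sum N A I = mat N N (\<lambda>rc. \<Sum>i\<in>I. A i $$ rc)"

(* Kronecker product: the basis vector e_a \<otimes> e_b has index a * dim + b,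
   where dim is the dimension of the second factor. *)
definition kron :: "complex mat \<Rightarrow> complex mat \<Rightarrow> complex mat" where
  "kron A B = mat (dim_row A * dim_row B) (dim_col A * dim_col B)
     (\<lambda>(r, c). A $$ (r div dim_row B, c div dim_col B) * B $$ (r mod dim_row B, c mod dim_col B))"

definition tensor :: "nat \<Rightarrow> (nat \<Rightarrow> complex mat) \<Rightarrow> complex mat" where
  "tensor m A = foldr kron (map A [1..<Suc m]) (1\<^sub>m 1)"

(* The space is the tensor product of the complex spaces of dimension d k for k = 1, ..., m,
   identified through its product basis with the complex vectors of length tensor_dim m d. *)
definition tensor_dim :: "nat \<Rightarrow> (nat \<Rightarrow> nat) \<Rightarrow> nat" where
  "tensor_dim m d = (\<Prod>k\<in>{1..m}. d k)"

lemma kron_carrier: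
  assumes "A \<in> carrier_mat a a" and "B \<in> carrier_mat b b"
  shows "kron A B \<in> carrier_mat (a * b) (a * b)"
  using carrier_matD[OF assms(1)] carrier_matD[OF assms(2)] unfolding kron_def by (intro carrier_matI) simp_all

lemma tensor_carrier:
  assumes "\<And>k. k \<in> {1..m} \<Longrightarrow> A k \<in> carrier_mat (d k) (d k)"
  shows "tensor m A \<in> carrier_mat (tensor_dim m d) (tensor_dim m d)"
proof -
  have "foldr kron (map A ks) (1\<^sub>m 1)
      \<in> carrier_mat (prod_list (map d ks)) (prod_list (map d ks))"
    if "set ks \<subseteq> {1..m}" for ks
    using that
  proof (induction ks)
    case Nil
    then show ?case by simp
  next
    case (Cons k ks)
    then have "k \<in> {1..m}" and "set ks \<subseteq> {1..m}" by simp_all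
    from kron_carrier[OF assms[OF this(1)] Cons.IH[OF this(2)]] show ?case by simp
  qed
  from this[of "[1..<Suc m]"] have "tensor m A
      \<in> carrier_mat (prod_list (map d [1..<Suc m])) (prod_list (map d [1..<Suc m]))"
    unfolding tensor_def by (simp add: atLeastLessThanSuc_atLeastAtMost del: upt_Suc)
  moreover have "prod_list (map d [1..<Suc m]) = tensor_dim m d"
    unfolding tensor_dim_def
    using prod.distinct_set_conv_list[OF distinct_upt, of d 1 "Suc m"]
    by (simp add: atLeastLessThanSuc_atLeastAtMost del: upt_Suc)
  ultimately show ?thesis by simp
qed

definition SEP :: "nat \<Rightarrow> (nat \<Rightarrow> nat) \<Rightarrow> complex mat set" where
  "SEP m d = {E \<in> psd_ops (tensor_dim m d).
     \<exists>(L::nat) (p :: nat \<Rightarrow> real) (\<sigma> :: nat \<Rightarrow> nat \<Rightarrow> complex mat).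
       (\<forall>l<L. 0 \<le> p l \<and> (\<forall>k\<in>{1..m}. \<sigma> l k \<in> states (d k))) \<and>
       E = mat_sum (tensor_dim m d) (\<lambda>l. complex_of_real (p l) \<cdot>\<^sub>m tensor m (\<sigma> l)) {..<L}}"

definition SEP_dual :: "nat \<Rightarrow> (nat \<Rightarrow> nat) \<Rightarrow> complex mat set" where
  "SEP_dual m d = {E \<in> hermitian_ops (tensor_dim m d). \<forall>F \<in> SEP m d. 0 \<le> mat_trace (E * F)}"

definition entanglement_witness :: "nat \<Rightarrow> (nat \<Rightarrow> nat) \<Rightarrow> complex mat \<Rightarrow> bool" where
  "entanglement_witness m d W \<longleftrightarrow> W \<in> SEP_dual m d - psd_ops (tensor_dim m d)"

definition ensemble :: "nat \<Rightarrow> nat \<Rightarrow> (nat \<Rightarrow> real) \<Rightarrow> (nat \<Rightarrow> complex mat) \<Rightarrow> bool" where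
  "ensemble N n \<eta> \<rho> \<longleftrightarrow>
     (\<forall>i\<in>{1..n}. 0 < \<eta> i \<and> \<rho> i \<in> states N) \<and> (\<Sum>i\<in>{1..n}. \<eta> i) = 1"

definition avg_state :: "nat \<Rightarrow> nat \<Rightarrow> (nat \<Rightarrow> real) \<Rightarrow> (nat \<Rightarrow> complex mat) \<Rightarrow> complex mat" where
  "avg_state N n \<eta> \<rho> = mat_sum N (\<lambda>i. complex_of_real (\<eta> i) \<cdot>\<^sub>m \<rho> i) {1..n}"

definition measurement :: "nat \<Rightarrow> nat \<Rightarrow> (nat \<Rightarrow> complex mat) \<Rightarrow> bool" where
  "measurement N n M \<longleftrightarrow> (\<forall>i\<in>{0..n}. M i \<in> psd_ops N) \<and> mat_sum N M {0..n} = 1\<^sub>m N"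

(* Traces of products of Hermitian operators are real, so Re discards nothing. *)
definition max_confidence ::
    "nat \<Rightarrow> nat \<Rightarrow> (nat \<Rightarrow> real) \<Rightarrow> (nat \<Rightarrow> complex mat) \<Rightarrow> nat \<Rightarrow> real" where
  "max_confidence N n \<eta> \<rho> j =
     (GREATEST c. \<exists>M. measurement N n M \<and> mat_trace (avg_state N n \<eta> \<rho> * M j) \<noteq> 0 \<and>
        c = \<eta> j * Re (mat_trace (\<rho> j * M j)) / Re (mat_trace (avg_state N n \<eta> \<rho> * M j)))"

definition Q_min ::
    "nat \<Rightarrow> (nat \<Rightarrow> nat) \<Rightarrow> nat \<Rightarrow> (nat \<Rightarrow> real) \<Rightarrow> (nat \<Rightarrow> complex mat) \<Rightarrow> nat \<Rightarrow> real" where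
  "Q_min m d n \<eta> \<rho> j = (LEAST q. complex_of_real q \<cdot>\<^sub>m avg_state (tensor_dim m d) n \<eta> \<rho>
                - complex_of_real (\<eta> j) \<cdot>\<^sub>m \<rho> j \<in> SEP_dual m d)"

end

theory Submission
  imports Defs
begin

text \<open>Write \<open>P\<close> for the average state, \<open>R\<close> for \<open>\<rho> j\<close> and \<open>G q = q P - \<eta> j R\<close>.
  Since \<open>P\<close> is positive semidefinite, the set of \<open>q\<close> with \<open>G q\<close> block positive and the set of
  \<open>q\<close> with \<open>G q\<close> positive semidefinite are closed half lines. Both contain 1, and both are
  bounded below because \<open>P\<close> has trace 1 and the identity is separable. The left end of the
  first is \<open>Q_min\<close> by definition. The left end \<open>C\<close> of the second is the maximum confidence:
  pairing \<open>G C\<close> with an effect gives the upper bound, and equality is attained by the projection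
  onto a null vector of \<open>G C\<close> outside the kernel of \<open>P\<close>. The theorem then reads
  \<open>Q_min \<le> q \<and> \<not> C \<le> q\<close>.\<close>

section \<open>Hermitian quadratic forms given by coefficient functions\<close>

text \<open>Coefficients and vectors are plain functions of which only the values below
  \<open>N\<close> count, so elimination steps and linear combinations need no carrier conditions.
  For Hermitian coefficients the sum is real and \<open>Re\<close> only changes the type.\<close>

definition hform :: "nat \<Rightarrow> (nat \<Rightarrow> nat \<Rightarrow> complex) \<Rightarrow> (nat \<Rightarrow> complex) \<Rightarrow> real" where
  "hform N a v = Re (\<Sum>i<N. \<Sum>j<N. a i j * v j * cnj (v i))"

definition hermitian_coeffs :: "nat \<Rightarrow> (nat \<Rightarrow> nat \<Rightarrow> complex) \<Rightarrow> bool" where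
  "hermitian_coeffs N a \<longleftrightarrow> (\<forall>i<N. \<forall>j<N. a j i = cnj (a i j))"

lemma hform_cong:
  assumes "\<And>i j. i < N \<Longrightarrow> j < N \<Longrightarrow> a i j = b i j"
  shows "hform N a v = hform N b v"
  unfolding hform_def using assms by simp

text \<open>Shaped for the pencil \<open>q P - \<eta> R\<close>; with \<open>y = -1\<close> it also
  acts as an addition rule.\<close>

lemma hform_scaled_diff:
  "hform N (\<lambda>i j. complex_of_real x * a i j - complex_of_real y * b i j) v
     = x * hform N a v - y * hform N b v"
proof -
  have "(\<Sum>i<N. \<Sum>j<N. (complex_of_real x * a i j - complex_of_real y * b i j) * v j * cnj (v i))
    = complex_of_real x * (\<Sum>i<N. \<Sum>j<N. a i j * v j * cnj (v i))
      - complex_of_real y * (\<Sum>i<N. \<Sum>j<N. b i j * v j * cnj (v i))"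
    by (simp add: sum_subtractf sum_distrib_left algebra_simps)
  then show ?thesis unfolding hform_def by simp
qed

lemma hform_scaled_sum:
  "hform N (\<lambda>i j. \<Sum>l\<in>I. complex_of_real (x l) * a l i j) v = (\<Sum>l\<in>I. x l * hform N (a l) v)"
proof (induction I rule: infinite_finite_induct)
  case (insert l I)
  \<comment> \<open>Two nested differences, with last coefficients \<open>0\<close> and
    \<open>-1\<close>, express scaling and addition through
    \<open>hform_scaled_diff\<close>.\<close>
  have "hform N (\<lambda>i j. complex_of_real 1 * (complex_of_real (x l) * a l i j - complex_of_real 0 * a l i j)
        - complex_of_real (-1) * (\<Sum>l\<in>I. complex_of_real (x l) * a l i j)) v
     = x l * hform N (a l) v + hform N (\<lambda>i j. \<Sum>l\<in>I. complex_of_real (x l) * a l i j) v"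
    unfolding hform_scaled_diff by simp
  then show ?case using insert by simp
qed (simp_all add: hform_def)

lemma hform_rank_one:
  "hform N (\<lambda>i j. w i * cnj (w j)) v = (cmod (\<Sum>j<N. cnj (w j) * v j))\<^sup>2"
proof -
  have "(\<Sum>i<N. \<Sum>j<N. w i * cnj (w j) * v j * cnj (v i))
      = (\<Sum>j<N. cnj (w j) * v j) * cnj (\<Sum>j<N. cnj (w j) * v j)"
    by (simp add: sum_product algebra_simps) (rule sum.swap)
  then show ?thesis
    unfolding hform_def by (simp add: complex_norm_square[symmetric] del: cnj_sum)
qed

text \<open>Expansion along a single coordinate: Hermitian symmetry makes the two cross terms
  conjugate to each other. It serves to test and to minimise the form in one coordinate.\<close>

lemma hform_add_unit:
  assumes "hermitian_coeffs N a" and "k < N"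
  shows "hform N a (\<lambda>i. v i + (if i = k then t else 0))
    = hform N a v + 2 * Re (t * cnj (\<Sum>j<N. a k j * v j)) + (cmod t)\<^sup>2 * Re (a k k)"
proof -
  let ?s = "\<Sum>j<N. a k j * v j"
  have cs: "cnj ?s = (\<Sum>i<N. a i k * cnj (v i))"
    unfolding cnj_sum
  proof (intro sum.cong refl)
    fix i assume "i \<in> {..<N}"
    then have "a i k = cnj (a k i)" using assms unfolding hermitian_coeffs_def by blast
    then show "cnj (a k i * v i) = a i k * cnj (v i)" by simp
  qed
  have "(\<Sum>i<N. \<Sum>j<N. a i j * (v j + (if j = k then t else 0)) * cnj (v i + (if i = k then t else 0)))
    = (\<Sum>i<N. \<Sum>j<N. a i j * v j * cnj (v i) + (if j = k then a i j * t * cnj (v i) else 0)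
        + (if i = k then a i j * v j * cnj t else 0)
        + (if i = k then (if j = k then a i j * t * cnj t else 0) else 0))"
    by (intro sum.cong) (auto simp: algebra_simps)
  also have "\<dots> = (\<Sum>i<N. \<Sum>j<N. a i j * v j * cnj (v i)) + (\<Sum>i<N. a i k * t * cnj (v i))
        + (\<Sum>j<N. a k j * v j * cnj t) + a k k * t * cnj t"
  proof -
    have c: "(\<Sum>j<N. if i = k then f j else 0) = (if i = k then (\<Sum>j<N. f j) else 0)" for i f
      by (simp add: if_distrib)
    show ?thesis using assms(2) by (simp add: sum.distrib c)
  qed
  also have "\<dots> = (\<Sum>i<N. \<Sum>j<N. a i j * v j * cnj (v i)) + t * cnj ?s + cnj (t * cnj ?s)
        + of_real ((cmod t)\<^sup>2) * a k k"
  proof -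
    have "(\<Sum>i<N. a i k * t * cnj (v i)) = t * cnj ?s"
      unfolding cs sum_distrib_left by (intro sum.cong) auto
    moreover have "(\<Sum>j<N. a k j * v j * cnj t) = cnj (t * cnj ?s)"
      unfolding complex_cnj_mult complex_cnj_cnj sum_distrib_left by (intro sum.cong) auto
    moreover have "a k k * t * cnj t = of_real ((cmod t)\<^sup>2) * a k k"
      unfolding complex_norm_square by simp
    ultimately show ?thesis by simp
  qed
  finally show ?thesis unfolding hform_def by (simp del: complex_cnj_mult cnj_sum)
qed

section \<open>Rank-one decomposition of positive semidefinite forms\<close>

text \<open>With a vanishing diagonal entry the form has no quadratic term in coordinate
  \<open>k\<close>, so a nonzero cross term would make it unbounded below.\<close>

lemma psd_zero_diagonal:
  assumes h: "hermitian_coeffs N a" and p: "\<And>v. 0 \<le> hform N a v"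
    and "k < N" "j < N" "a k k = 0"
  shows "a k j = 0"
proof (rule ccontr)
  assume nz: "a k j \<noteq> 0"
  define e where "e = (\<lambda>i. if i = j then 1 else (0::complex))"
  have s: "(\<Sum>l<N. a k l * e l) = a k j"
    using \<open>j < N\<close> by (simp add: e_def if_distrib cong: if_cong)
  have "0 \<le> hform N a e - 2 * x * (cmod (a k j))\<^sup>2" for x
  proof -
    have "Re (complex_of_real (- x) * a k j * cnj (a k j)) = - x * (cmod (a k j))\<^sup>2"
      by (simp add: mult.assoc complex_norm_square[symmetric])
    then show ?thesis
      using p[of "\<lambda>i. e i + (if i = k then complex_of_real (- x) * a k j else 0)"]
      unfolding hform_add_unit[OF h \<open>k < N\<close>] s using \<open>a k k = 0\<close> by simp
  qed
  \<comment> \<open>At this \<open>x\<close> the expression claimed to be nonnegative equals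
    \<open>-1\<close>.\<close>
  from this[of "(hform N a e + 1) / (2 * (cmod (a k j))\<^sup>2)"] nz show False by simp
qed

text \<open>Cholesky elimination: subtracting the rank-one form of the pivot column leaves the minimum of
  the form over the pivot coordinate, which is again nonnegative.\<close>

lemma psd_rank_one_decomposition_aux:
  assumes "hermitian_coeffs N a" and "\<And>v. 0 \<le> hform N a v" and "k \<le> N"
    and "\<And>i j. i < N \<Longrightarrow> j < N \<Longrightarrow> i < k \<or> j < k \<Longrightarrow> a i j = 0"
  shows "\<exists>ws. \<forall>i<N. \<forall>j<N. a i j = (\<Sum>w\<leftarrow>ws. w i * cnj (w j))"
  using assms
proof (induction "N - k" arbitrary: k a)
  case 0
  then have "\<forall>i<N. \<forall>j<N. a i j = (\<Sum>w\<leftarrow>[]. w i * cnj (w j))" by simp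
  then show ?case by blast
next
  case (Suc x)
  then have k: "k < N" and x: "x = N - Suc k" and k': "Suc k \<le> N" by simp_all
  note h = Suc.prems(1) and p = Suc.prems(2)
  have hD: "a j i = cnj (a i j)" if "i < N" "j < N" for i j
    using h that unfolding hermitian_coeffs_def by blast
  show ?case
  proof (cases "a k k = 0")
    case True
    \<comment> \<open>A zero pivot already has zero row and column, so \<open>k\<close> advances
      without any subtraction.\<close>
    have z: "a k j = 0" "a j k = 0" if "j < N" for j
      using psd_zero_diagonal[OF h p k that True] hD[OF k that] by simp_all
    show ?thesis
    proof (rule Suc.hyps(1)[OF x h p k'])
      fix i j assume "i < N" "j < N" "i < Suc k \<or> j < Suc k"
      then show "a i j = 0" using Suc.prems(4)[of i j] z less_Suc_eq by metis
    qed
  next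
    case False
    define r where "r = Re (a k k)"
    have ar: "a k k = complex_of_real r"
      using hD[OF k k] unfolding r_def by (metis Reals_cnj_iff of_real_Re)
    have key: "hform N a (\<lambda>i. v i + (if i = k then t else 0))
        = hform N a v + 2 * Re (t * cnj (\<Sum>j<N. a k j * v j)) + (cmod t)\<^sup>2 * r" for v t
      using hform_add_unit[OF h k] unfolding r_def .
    have "hform N a (\<lambda>i. 0 + (if i = k then 1 else 0)) = r"
      unfolding key by (simp add: hform_def)
    then have "0 \<le> r" using p by metis
    then have r: "0 < r" using False ar by auto
    \<comment> \<open>Scaled pivot column: \<open>w i * cnj (w j)\<close> agrees with
      \<open>a\<close> on row and column \<open>k\<close>, so \<open>b\<close> vanishes
      there.\<close>
    define w where "w i = a i k / complex_of_real (sqrt r)" for i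
    define b where "b i j = a i j - w i * cnj (w j)" for i j
    have ww: "w i * cnj (w j) = a i k * cnj (a j k) / complex_of_real r" for i j
      unfolding w_def using r by (simp flip: of_real_mult)
    have hb: "hermitian_coeffs N b"
      unfolding hermitian_coeffs_def
    proof (intro allI impI)
      fix i j assume "i < N" "j < N"
      then have "a j i = cnj (a i j)" by (rule hD)
      then show "b j i = cnj (b i j)" unfolding b_def by simp
    qed
    have pb: "0 \<le> hform N b v" for v
    proof -
      define s where "s = (\<Sum>j<N. a k j * v j)"
      have ws: "(\<Sum>j<N. cnj (w j) * v j) = s / complex_of_real (sqrt r)"
        unfolding s_def sum_divide_distrib
      proof (intro sum.cong refl)
        fix j assume "j \<in> {..<N}"
        then have "a k j = cnj (a j k)" using k by (intro hD) auto
        then show "cnj (w j) * v j = a k j * v j / complex_of_real (sqrt r)" unfolding w_def by simp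
      qed
      have "hform N b v = hform N a v - (cmod s)\<^sup>2 / r"
        using hform_scaled_diff[of N 1 a 1 "\<lambda>i j. w i * cnj (w j)" v] r
        unfolding hform_rank_one ws b_def by (simp add: norm_divide power_divide)
      \<comment> \<open>The shift by \<open>- s / r\<close> minimises the expansion over coordinate
        \<open>k\<close>; the minimum is the value of the form of \<open>b\<close> at
        \<open>v\<close>.\<close>
      moreover have "hform N a (\<lambda>i. v i + (if i = k then - s / complex_of_real r else 0))
          = hform N a v - (cmod s)\<^sup>2 / r"
      proof -
        have "Re (- s / complex_of_real r * cnj s) = - (cmod s)\<^sup>2 / r"
          using r cmod_power2[of s] by (simp add: power2_eq_square field_simps)
        then show ?thesis unfolding key s_def[symmetric] using r
          by (simp add: norm_divide power_divide power2_eq_square)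
      qed
      ultimately show ?thesis using p by metis
    qed
    have "\<exists>ws. \<forall>i<N. \<forall>j<N. b i j = (\<Sum>w\<leftarrow>ws. w i * cnj (w j))"
    proof (rule Suc.hyps(1)[OF x hb pb k'])
      fix i j assume ij: "i < N" "j < N" "i < Suc k \<or> j < Suc k"
      consider "i < k \<or> j < k" | "i = k" | "j = k" using ij(3) by linarith
      then show "b i j = 0"
      proof cases
        case 1
        then show ?thesis using Suc.prems(4) ij k unfolding b_def ww by auto
      next
        case 2
        then show ?thesis using hD[OF ij(2) k] r unfolding b_def ww by (simp add: ar)
      next
        case 3
        then show ?thesis using r unfolding b_def ww by (simp add: ar)
      qed
    qed
    then obtain ws where "\<forall>i<N. \<forall>j<N. b i j = (\<Sum>w\<leftarrow>ws. w i * cnj (w j))" by blast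
    then have "\<forall>i<N. \<forall>j<N. a i j = (\<Sum>w\<leftarrow>w # ws. w i * cnj (w j))"
      unfolding b_def by (simp add: algebra_simps)
    then show ?thesis by blast
  qed
qed

lemma psd_rank_one_decomposition:
  assumes "hermitian_coeffs N a" and "\<And>v. 0 \<le> hform N a v"
  shows "\<exists>ws. \<forall>i<N. \<forall>j<N. a i j = (\<Sum>w\<leftarrow>ws. w i * cnj (w j))"
  using psd_rank_one_decomposition_aux[OF assms, of 0] by simp

lemma hform_sum_rank_one:
  "hform N (\<lambda>i j. \<Sum>w\<leftarrow>ws. w i * cnj (w j)) v
     = (\<Sum>w\<leftarrow>ws. (cmod (\<Sum>j<N. cnj (w j) * v j))\<^sup>2)"
proof (induction ws)
  case (Cons w ws)
  have "hform N (\<lambda>i j. \<Sum>w\<leftarrow>w # ws. w i * cnj (w j)) v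
      = hform N (\<lambda>i j. w i * cnj (w j)) v + hform N (\<lambda>i j. \<Sum>w\<leftarrow>ws. w i * cnj (w j)) v"
    using hform_scaled_diff[of N 1 "\<lambda>i j. w i * cnj (w j)" "-1" _ v] by simp
  then show ?case using Cons hform_rank_one by simp
qed (simp add: hform_def)

section \<open>Domination of one semidefinite form by another\<close>

text \<open>The factor 2 absorbs the cross term; in this shape the bound passes to sums of squared
  functionals.\<close>

lemma norm_add_square_le: "(norm (x + y))\<^sup>2 \<le> 2 * (norm x)\<^sup>2 + 2 * (norm (y :: 'a :: real_normed_vector))\<^sup>2"
proof -
  have "(norm (x + y))\<^sup>2 \<le> (norm x + norm y)\<^sup>2"
    by (intro power_mono norm_triangle_ineq) simp
  also have "\<dots> \<le> 2 * (norm x)\<^sup>2 + 2 * (norm y)\<^sup>2"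
    using sum_squares_bound[of "norm x" "norm y"] by (simp add: power2_sum)
  finally show ?thesis .
qed

text \<open>Splitting off one functional at a time: on a complement of its kernel the form is controlled by
  its value at a single vector.\<close>

lemma form_dominated_by_functionals:
  fixes V :: "(nat \<Rightarrow> complex) set" and f :: "'w \<Rightarrow> (nat \<Rightarrow> complex) \<Rightarrow> complex"
  assumes "\<And>u v c. u \<in> V \<Longrightarrow> v \<in> V \<Longrightarrow> (\<lambda>i. u i + c * v i) \<in> V"
    and "\<And>w u v c. f w (\<lambda>i. u i + c * v i) = f w u + c * f w v"
    and "\<And>u v c. g (\<lambda>i. u i + c * v i) \<le> 2 * g u + 2 * (cmod c)\<^sup>2 * g v"
    and "\<And>v. v \<in> V \<Longrightarrow> (\<forall>w\<in>set ws. f w v = 0) \<Longrightarrow> g v \<le> 0"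
  shows "\<exists>C\<ge>0. \<forall>v\<in>V. g v \<le> C * (\<Sum>w\<leftarrow>ws. (cmod (f w v))\<^sup>2)"
  using assms(1,4)
proof (induction ws arbitrary: V)
  case Nil
  then show ?case by auto
next
  case (Cons w0 ws)
  let ?S = "\<lambda>v. \<Sum>w\<leftarrow>ws. (cmod (f w v))\<^sup>2"
  have S_nonneg: "0 \<le> ?S v" for v by (intro sum_list_nonneg) auto
  \<comment> \<open>The kernel of \<open>f w0\<close> in \<open>V\<close> is closed under the same
    combinations, and vanishing of \<open>ws\<close> there means vanishing of all of
    \<open>w0 # ws\<close>.\<close>
  have "\<exists>C\<ge>0. \<forall>v\<in>{v \<in> V. f w0 v = 0}. g v \<le> C * ?S v"
    by (rule Cons.IH) (use Cons.prems assms(2) in auto)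
  then obtain C where C: "0 \<le> C" "\<And>v. v \<in> V \<Longrightarrow> f w0 v = 0 \<Longrightarrow> g v \<le> C * ?S v" by auto
  show ?case
  proof (cases "\<forall>v\<in>V. f w0 v = 0")
    case True
    then show ?thesis using C by auto
  next
    case False
    then obtain e where e: "e \<in> V" "f w0 e \<noteq> 0" by auto
    \<comment> \<open>\<open>D\<close> collects the coefficients that arise from splitting
      \<open>v\<close> as \<open>u + c * e\<close> with \<open>u\<close> in the kernel of
      \<open>f w0\<close>. The values at \<open>e\<close> come with the factor
      \<open>(cmod c)\<^sup>2\<close>, hence the divisions; the absolute value is there because
      \<open>g e\<close> may be negative.\<close>
    define D where "D = 4 * C + 4 * C * ?S e / (cmod (f w0 e))\<^sup>2 + 2 * \<bar>g e\<bar> / (cmod (f w0 e))\<^sup>2"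
    have "0 \<le> D" unfolding D_def using C S_nonneg by (intro add_nonneg_nonneg) auto
    have "g v \<le> D * ((cmod (f w0 v))\<^sup>2 + ?S v)" if "v \<in> V" for v
    proof -
      define c where "c = f w0 v / f w0 e"
      define u where "u = (\<lambda>i. v i + (- c) * e i)"
      have u: "u \<in> V" "f w0 u = 0"
        using Cons.prems(1)[OF that e(1), of "- c"] assms(2)[of w0 v "- c" e] e(2)
        unfolding u_def c_def by simp_all
      have cc: "(cmod c)\<^sup>2 = (cmod (f w0 v))\<^sup>2 / (cmod (f w0 e))\<^sup>2"
        unfolding c_def by (simp add: norm_divide power_divide)
      have "?S u \<le> (\<Sum>w\<leftarrow>ws. 2 * (cmod (f w v))\<^sup>2 + 2 * (cmod c)\<^sup>2 * (cmod (f w e))\<^sup>2)"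
      proof (rule sum_list_mono)
        fix w
        show "(cmod (f w u))\<^sup>2 \<le> 2 * (cmod (f w v))\<^sup>2 + 2 * (cmod c)\<^sup>2 * (cmod (f w e))\<^sup>2"
          using norm_add_square_le[of "f w v" "- c * f w e"] unfolding u_def assms(2)
          by (simp add: norm_mult power_mult_distrib)
      qed
      also have "\<dots> = 2 * ?S v + 2 * (cmod c)\<^sup>2 * ?S e"
        by (simp add: sum_list_addf sum_list_const_mult)
      finally have "g u \<le> C * (2 * ?S v + 2 * (cmod c)\<^sup>2 * ?S e)"
        using C(2)[OF u] mult_left_mono[OF _ C(1)] by fastforce
      moreover have "g v \<le> 2 * g u + 2 * (cmod c)\<^sup>2 * g e"
        using assms(3)[of u c e] unfolding u_def by simp
      moreover have "2 * (cmod c)\<^sup>2 * g e \<le> 2 * (cmod c)\<^sup>2 * \<bar>g e\<bar>"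
        by (intro mult_left_mono) auto
      ultimately have "g v \<le> 4 * C * ?S v + 4 * C * (cmod c)\<^sup>2 * ?S e + 2 * (cmod c)\<^sup>2 * \<bar>g e\<bar>"
        by (simp add: algebra_simps)
      also have "\<dots> = 4 * C * ?S v + (D - 4 * C) * (cmod (f w0 v))\<^sup>2"
        unfolding D_def cc by (simp add: algebra_simps)
      also have "\<dots> \<le> D * ?S v + D * (cmod (f w0 v))\<^sup>2"
      proof (intro add_mono mult_right_mono S_nonneg)
        show "4 * C \<le> D" unfolding D_def using C S_nonneg[of e] by simp
        show "D - 4 * C \<le> D" using C by simp
      qed (rule zero_le_power2)
      finally show ?thesis by (simp add: algebra_simps)
    qed
    then show ?thesis using \<open>0 \<le> D\<close> by auto
  qed
qed

text \<open>Both forms are sums of squared moduli of linear functionals, and the zeros of the form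
  of \<open>b\<close> are the common kernel of its functionals. The preceding lemma then applies
  with the form of \<open>a\<close> as \<open>g\<close>.\<close>

lemma psd_form_dominated:
  assumes ha: "hermitian_coeffs N a" and pa: "\<And>v. 0 \<le> hform N a v"
    and hb: "hermitian_coeffs N b" and pb: "\<And>v. 0 \<le> hform N b v"
    and ker: "\<And>v. hform N b v = 0 \<Longrightarrow> hform N a v = 0"
  obtains C where "0 < C" and "\<And>v. hform N a v \<le> C * hform N b v"
proof -
  obtain us where us: "\<forall>i<N. \<forall>j<N. a i j = (\<Sum>w\<leftarrow>us. w i * cnj (w j))"
    using psd_rank_one_decomposition[OF ha pa] by blast
  obtain ws where ws: "\<forall>i<N. \<forall>j<N. b i j = (\<Sum>w\<leftarrow>ws. w i * cnj (w j))"
    using psd_rank_one_decomposition[OF hb pb] by blast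
  define f where "f w v = (\<Sum>j<N. cnj (w j) * v j)" for w v :: "nat \<Rightarrow> complex"
  have f: "f w (\<lambda>i. u i + c * v i) = f w u + c * f w v" for w u v c
    unfolding f_def by (simp add: algebra_simps sum.distrib sum_distrib_left)
  have A: "hform N a v = (\<Sum>w\<leftarrow>us. (cmod (f w v))\<^sup>2)" for v
    using hform_cong[of N a "\<lambda>i j. \<Sum>w\<leftarrow>us. w i * cnj (w j)" v] us unfolding hform_sum_rank_one f_def by blast
  have B: "hform N b v = (\<Sum>w\<leftarrow>ws. (cmod (f w v))\<^sup>2)" for v
    using hform_cong[of N b "\<lambda>i j. \<Sum>w\<leftarrow>ws. w i * cnj (w j)" v] ws unfolding hform_sum_rank_one f_def by blast
  have "\<exists>C\<ge>0. \<forall>v\<in>UNIV. hform N a v \<le> C * (\<Sum>w\<leftarrow>ws. (cmod (f w v))\<^sup>2)"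
  proof (rule form_dominated_by_functionals[OF _ f])
    fix u v :: "nat \<Rightarrow> complex" and c
    have "(\<Sum>w\<leftarrow>us. (cmod (f w (\<lambda>i. u i + c * v i)))\<^sup>2)
        \<le> (\<Sum>w\<leftarrow>us. 2 * (cmod (f w u))\<^sup>2 + 2 * (cmod c)\<^sup>2 * (cmod (f w v))\<^sup>2)"
    proof (rule sum_list_mono)
      fix w
      show "(cmod (f w (\<lambda>i. u i + c * v i)))\<^sup>2 \<le> 2 * (cmod (f w u))\<^sup>2 + 2 * (cmod c)\<^sup>2 * (cmod (f w v))\<^sup>2"
        using norm_add_square_le[of "f w u" "c * f w v"] unfolding f
        by (simp add: norm_mult power_mult_distrib)
    qed
    then show "hform N a (\<lambda>i. u i + c * v i) \<le> 2 * hform N a u + 2 * (cmod c)\<^sup>2 * hform N a v"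
      unfolding A by (simp add: sum_list_addf sum_list_const_mult)
  next
    fix v assume "\<forall>w\<in>set ws. f w v = 0"
    then have "hform N b v = 0" unfolding B by (simp cong: map_cong)
    then show "hform N a v \<le> 0" using ker by simp
  qed (rule UNIV_I)
  then obtain C where C: "0 \<le> C" "\<And>v. hform N a v \<le> C * hform N b v" unfolding B by auto
  show ?thesis
  proof (rule that)
    \<comment> \<open>Adding 1 makes the constant positive, so that it can be divided by; the bound
      is only weakened, the form of \<open>b\<close> being nonnegative.\<close>
    show "0 < C + 1" using C by simp
    show "hform N a v \<le> (C + 1) * hform N b v" for v
      using C(2)[of v] pb[of v] by (simp add: algebra_simps)
  qed
qed

section \<open>Matrices and their forms\<close>

abbreviation entries :: "complex mat \<Rightarrow> nat \<Rightarrow> nat \<Rightarrow> complex" where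
  "entries A \<equiv> \<lambda>i j. A $$ (i, j)"

lemma hermitian_coeffsI:
  "(\<And>i j. i < N \<Longrightarrow> j < N \<Longrightarrow> a j i = cnj (a i j)) \<Longrightarrow> hermitian_coeffs N a"
  unfolding hermitian_coeffs_def by blast

lemma hermitian_coeffsD:
  "hermitian_coeffs N a \<Longrightarrow> i < N \<Longrightarrow> j < N \<Longrightarrow> cnj (a i j) = a j i"
  unfolding hermitian_coeffs_def by (rule sym) blast

text \<open>Conjugation swaps the two summation indices, so the sum equals its own
  conjugate.\<close>

lemma hermitian_form_real:
  assumes "hermitian_coeffs N a"
  shows "(\<Sum>i<N. \<Sum>j<N. a i j * v j * cnj (v i)) = complex_of_real (hform N a v)"
proof -
  let ?z = "\<Sum>i<N. \<Sum>j<N. a i j * v j * cnj (v i)"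
  have "cnj ?z = (\<Sum>i<N. \<Sum>j<N. a j i * v i * cnj (v j))"
    unfolding cnj_sum complex_cnj_mult complex_cnj_cnj
    by (intro sum.cong refl) (simp add: hermitian_coeffsD[OF assms])
  also have "\<dots> = ?z" by (rule sum.swap)
  finally have "?z \<in> \<real>" unfolding Reals_cnj_iff .
  then show ?thesis unfolding hform_def by (rule of_real_Re[symmetric])
qed

lemma hform_scale_vector:
  "hform N a (\<lambda>i. complex_of_real c * v i) = c\<^sup>2 * hform N a v"
proof -
  have "(\<Sum>i<N. \<Sum>j<N. a i j * (complex_of_real c * v j) * cnj (complex_of_real c * v i))
      = complex_of_real (c\<^sup>2) * (\<Sum>i<N. \<Sum>j<N. a i j * v j * cnj (v i))"
    unfolding sum_distrib_left by (intro sum.cong refl) (simp add: power2_eq_square)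
  then show ?thesis unfolding hform_def by simp
qed

lemma hform_diagonal:
  "hform N (\<lambda>i j. if i = j then complex_of_real c else 0) v = c * (\<Sum>i<N. (cmod (v i))\<^sup>2)"
proof -
  have "(\<Sum>i<N. \<Sum>j<N. (if i = j then complex_of_real c else 0) * v j * cnj (v i))
     = (\<Sum>i<N. \<Sum>j<N. if i = j then complex_of_real c * (v j * cnj (v j)) else 0)"
    by (intro sum.cong refl) simp
  also have "\<dots> = complex_of_real (c * (\<Sum>i<N. (cmod (v i))\<^sup>2))"
    unfolding of_real_mult of_real_sum complex_norm_square sum_distrib_left by simp
  finally show ?thesis unfolding hform_def by simp
qed

lemma hform_unit_vector:
  assumes "k < N"
  shows "hform N a (\<lambda>i. if i = k then 1 else 0) = Re (a k k)"
proof -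
  have "(\<Sum>j<N. a i j * (if j = k then 1 else 0) * cnj (if i = k then 1 else 0))
      = (\<Sum>j<N. if j = k then if i = k then a k k else 0 else 0)" for i
    by (intro sum.cong refl) simp
  then show ?thesis unfolding hform_def using assms by simp
qed

lemma mat_adjoint_index:
  assumes "A \<in> carrier_mat N N" "i < N" "j < N"
  shows "mat_adjoint A $$ (i, j) = cnj (A $$ (j, i))"
  using assms unfolding mat_adjoint_def by (simp add: mat_of_rows_index)

lemma mat_adjoint_carrier:
  "A \<in> carrier_mat N N \<Longrightarrow> mat_adjoint A \<in> carrier_mat N N"
  unfolding mat_adjoint_def by (auto simp: mat_of_rows_def)

lemma hermitian_ops_iff:
  "A \<in> hermitian_ops N \<longleftrightarrow> A \<in> carrier_mat N N \<and> hermitian_coeffs N (entries A)"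
proof (cases "A \<in> carrier_mat N N")
  case True
  have "hermitian_coeffs N (entries A)" if eq: "mat_adjoint A = A"
    by (rule hermitian_coeffsI) (metis eq mat_adjoint_index[OF True])
  moreover have "mat_adjoint A = A" if h: "hermitian_coeffs N (entries A)"
    using True mat_adjoint_carrier[OF True]
    by (intro eq_matI) (simp_all add: mat_adjoint_index[OF True] hermitian_coeffsD[OF h])
  ultimately show ?thesis using True unfolding hermitian_ops_def by blast
qed (simp add: hermitian_ops_def)

lemma psd_ops_hermitian: "A \<in> psd_ops N \<Longrightarrow> A \<in> hermitian_ops N"
  unfolding psd_ops_def by blast

lemma mult_mat_vec_form:
  assumes "A \<in> carrier_mat N N" "v \<in> carrier_vec N"
  shows "(A *\<^sub>v v) \<bullet>c v = (\<Sum>i<N. \<Sum>j<N. A $$ (i, j) * (v $ j) * cnj (v $ i))"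
proof -
  have "(A *\<^sub>v v) \<bullet>c v = (\<Sum>i<N. (\<Sum>j<N. A $$ (i, j) * (v $ j)) * cnj (v $ i))"
    using assms by (simp add: scalar_prod_def atLeast0LessThan row_def)
  then show ?thesis by (simp add: sum_distrib_right)
qed

text \<open>The form reads only the first \<open>N\<close> values, so vectors of length
  \<open>N\<close> and arbitrary functions give the same condition; Hermitian symmetry reduces the
  complex order to the real one.\<close>

lemma psd_ops_iff:
  "A \<in> psd_ops N \<longleftrightarrow> A \<in> carrier_mat N N \<and> hermitian_coeffs N (entries A)
     \<and> (\<forall>v. 0 \<le> hform N (entries A) v)"
proof (cases "A \<in> carrier_mat N N \<and> hermitian_coeffs N (entries A)")
  case True
  then have A: "A \<in> carrier_mat N N" and h: "hermitian_coeffs N (entries A)" by auto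
  have form: "0 \<le> (A *\<^sub>v v) \<bullet>c v \<longleftrightarrow> 0 \<le> hform N (entries A) (($) v)" if "v \<in> carrier_vec N" for v
    unfolding mult_mat_vec_form[OF A that] hermitian_form_real[OF h]
    by (simp add: less_eq_complex_def)
  have vec: "hform N (entries A) v = hform N (entries A) (($) (vec N v))" for v
    unfolding hform_def by (intro arg_cong[of _ _ Re] sum.cong refl) simp
  have "(\<forall>v\<in>carrier_vec N. 0 \<le> (A *\<^sub>v v) \<bullet>c v) \<longleftrightarrow> (\<forall>v. 0 \<le> hform N (entries A) v)"
  proof (intro iffI allI ballI)
    fix v :: "nat \<Rightarrow> complex" assume "\<forall>v\<in>carrier_vec N. 0 \<le> (A *\<^sub>v v) \<bullet>c v"
    then have "0 \<le> (A *\<^sub>v vec N v) \<bullet>c vec N v" by (rule bspec) (rule vec_carrier)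
    then show "0 \<le> hform N (entries A) v"
      by (subst vec) (rule form[OF vec_carrier, THEN iffD1])
  next
    fix v :: "complex vec" assume "\<forall>v. 0 \<le> hform N (entries A) v" and v: "v \<in> carrier_vec N"
    then show "0 \<le> (A *\<^sub>v v) \<bullet>c v" by (intro form[OF v, THEN iffD2]) blast
  qed
  then show ?thesis using True unfolding psd_ops_def hermitian_ops_iff by blast
qed (auto simp: psd_ops_def hermitian_ops_iff)

section \<open>Traces of products and positivity of operator pencils\<close>

lemma mat_trace_mult:
  assumes "A \<in> carrier_mat N N" "B \<in> carrier_mat N N"
  shows "mat_trace (A * B) = (\<Sum>i<N. \<Sum>j<N. A $$ (i, j) * B $$ (j, i))"
  using assms unfolding mat_trace_def by (simp add: scalar_prod_def atLeast0LessThan)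

text \<open>Conjugation transposes both factors, and swapping the summation indices restores the
  trace. Such traces can therefore be compared through their real parts.\<close>

lemma mat_trace_hermitian_mult_real:
  assumes "A \<in> hermitian_ops N" "B \<in> hermitian_ops N"
  shows "Im (mat_trace (A * B)) = 0"
proof -
  have A: "A \<in> carrier_mat N N" "hermitian_coeffs N (entries A)"
    and B: "B \<in> carrier_mat N N" "hermitian_coeffs N (entries B)"
    using assms by (auto simp: hermitian_ops_iff)
  have "cnj (mat_trace (A * B)) = (\<Sum>i<N. \<Sum>j<N. A $$ (j, i) * B $$ (i, j))"
    unfolding mat_trace_mult[OF A(1) B(1)] cnj_sum complex_cnj_mult
    by (intro sum.cong refl) (simp add: hermitian_coeffsD[OF A(2)] hermitian_coeffsD[OF B(2)])
  also have "\<dots> = mat_trace (A * B)"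
    unfolding mat_trace_mult[OF A(1) B(1)] by (rule sum.swap)
  finally have "mat_trace (A * B) \<in> \<real>" unfolding Reals_cnj_iff .
  then show ?thesis by (simp only: complex_is_Real_iff)
qed

text \<open>By linearity it suffices that pairing \<open>A\<close> with one rank-one term evaluates
  the form of \<open>A\<close> at its vector.\<close>

lemma mat_trace_mult_rank_one_sum:
  assumes "A \<in> carrier_mat N N" "B \<in> carrier_mat N N"
    and "\<forall>i<N. \<forall>j<N. B $$ (i, j) = (\<Sum>w\<leftarrow>ws. w i * cnj (w j))"
  shows "Re (mat_trace (A * B)) = (\<Sum>w\<leftarrow>ws. hform N (entries A) w)"
proof -
  have "Re (\<Sum>i<N. \<Sum>j<N. A $$ (i, j) * (\<Sum>w\<leftarrow>ws. w j * cnj (w i)))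
      = (\<Sum>w\<leftarrow>ws. hform N (entries A) w)"
  proof (induction ws)
    case (Cons w ws)
    then show ?case
      unfolding hform_def by (simp add: sum.distrib distrib_left mult.assoc)
  qed simp
  then show ?thesis unfolding mat_trace_mult[OF assms(1,2)] using assms(3) by simp
qed

text \<open>A rank-one decomposition of \<open>B\<close> turns the trace into a sum of values of the
  form of \<open>A\<close>.\<close>

lemma mat_trace_psd_mult_nonneg:
  assumes "A \<in> psd_ops N" "B \<in> psd_ops N"
  shows "0 \<le> Re (mat_trace (A * B))"
proof -
  obtain ws where "\<forall>i<N. \<forall>j<N. B $$ (i, j) = (\<Sum>w\<leftarrow>ws. w i * cnj (w j))"
    using psd_rank_one_decomposition[of N "entries B"] assms(2) unfolding psd_ops_iff by blast
  then have "Re (mat_trace (A * B)) = (\<Sum>w\<leftarrow>ws. hform N (entries A) w)"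
    using assms by (intro mat_trace_mult_rank_one_sum) (auto simp: psd_ops_iff)
  moreover have "0 \<le> (\<Sum>w\<leftarrow>ws. hform N (entries A) w)"
    using assms(1) by (intro sum_list_nonneg) (auto simp: psd_ops_iff)
  ultimately show ?thesis by simp
qed

lemma mat_trace_scaled_diff_mult:
  assumes "A \<in> carrier_mat N N" "B \<in> carrier_mat N N" "F \<in> carrier_mat N N"
  shows "mat_trace ((x \<cdot>\<^sub>m A - y \<cdot>\<^sub>m B) * F) = x * mat_trace (A * F) - y * mat_trace (B * F)"
proof -
  have c: "x \<cdot>\<^sub>m A - y \<cdot>\<^sub>m B \<in> carrier_mat N N"
    using assms by (intro minus_carrier_mat smult_carrier_mat)
  have "mat_trace ((x \<cdot>\<^sub>m A - y \<cdot>\<^sub>m B) * F)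
      = (\<Sum>i<N. \<Sum>j<N. x * (A $$ (i, j) * F $$ (j, i)) - y * (B $$ (i, j) * F $$ (j, i)))"
    unfolding mat_trace_mult[OF c assms(3)] using assms
    by (intro sum.cong refl) (simp add: algebra_simps)
  then show ?thesis
    unfolding mat_trace_mult[OF assms(1,3)] mat_trace_mult[OF assms(2,3)]
    by (simp add: sum_subtractf sum_distrib_left)
qed

lemma scaled_diff_hermitian:
  assumes "A \<in> hermitian_ops N" "B \<in> hermitian_ops N"
  shows "complex_of_real x \<cdot>\<^sub>m A - complex_of_real y \<cdot>\<^sub>m B \<in> hermitian_ops N"
proof -
  have A: "A \<in> carrier_mat N N" "hermitian_coeffs N (entries A)"
    and B: "B \<in> carrier_mat N N" "hermitian_coeffs N (entries B)"
    using assms by (auto simp: hermitian_ops_iff)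
  then show ?thesis
    unfolding hermitian_ops_iff
    by (auto intro!: hermitian_coeffsI simp: hermitian_coeffsD[OF A(2)] hermitian_coeffsD[OF B(2)])
qed

text \<open>Positivity of the pencil becomes a family of real inequalities, the shape in which
  thresholds are found.\<close>

lemma scaled_diff_psd_iff:
  assumes "A \<in> hermitian_ops N" "B \<in> hermitian_ops N"
  shows "complex_of_real x \<cdot>\<^sub>m A - complex_of_real y \<cdot>\<^sub>m B \<in> psd_ops N
    \<longleftrightarrow> (\<forall>v. y * hform N (entries B) v \<le> x * hform N (entries A) v)"
proof -
  have "hform N (entries (complex_of_real x \<cdot>\<^sub>m A - complex_of_real y \<cdot>\<^sub>m B)) v
      = x * hform N (entries A) v - y * hform N (entries B) v" for v
    unfolding hform_scaled_diff[symmetric] using assms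
    by (intro hform_cong) (auto simp: hermitian_ops_iff)
  then show ?thesis
    using scaled_diff_hermitian[OF assms] unfolding psd_ops_iff hermitian_ops_iff by auto
qed

lemma one_mat_psd: "1\<^sub>m N \<in> psd_ops N"
proof -
  have "hform N (entries (1\<^sub>m N)) v = 1 * (\<Sum>i<N. (cmod (v i))\<^sup>2)" for v
    unfolding hform_diagonal[symmetric] by (intro hform_cong) simp
  then show ?thesis unfolding psd_ops_iff
    by (auto intro!: hermitian_coeffsI sum_nonneg)
qed

lemma smult_psd:
  assumes "A \<in> psd_ops N" "0 \<le> c"
  shows "complex_of_real c \<cdot>\<^sub>m A \<in> psd_ops N"
proof -
  have "A \<in> hermitian_ops N" using assms(1) by (rule psd_ops_hermitian)
  \<comment> \<open>A subtracted zero multiple makes the criterion for differences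
    applicable.\<close>
  then have "complex_of_real c \<cdot>\<^sub>m A - complex_of_real 0 \<cdot>\<^sub>m A \<in> psd_ops N"
    using assms by (subst scaled_diff_psd_iff) (auto simp: psd_ops_iff)
  moreover have "complex_of_real c \<cdot>\<^sub>m A - complex_of_real 0 \<cdot>\<^sub>m A = complex_of_real c \<cdot>\<^sub>m A"
    using assms by (intro eq_matI) auto
  ultimately show ?thesis by simp
qed

section \<open>Separability of the identity\<close>

lemma kron_scaled_identity:
  "kron (x \<cdot>\<^sub>m 1\<^sub>m a) (y \<cdot>\<^sub>m 1\<^sub>m b) = (x * y) \<cdot>\<^sub>m 1\<^sub>m (a * b)"
proof (rule eq_matI)
  fix i j assume "i < dim_row ((x * y) \<cdot>\<^sub>m 1\<^sub>m (a * b))" "j < dim_col ((x * y) \<cdot>\<^sub>m 1\<^sub>m (a * b))"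
  then have ij: "i < a * b" "j < a * b" by simp_all
  then have "0 < b" by (cases b) auto
  \<comment> \<open>Quotient and remainder together determine the index, so the product of the two
    Kronecker deltas is a single one.\<close>
  have "i div b = j div b \<and> i mod b = j mod b \<longleftrightarrow> i = j"
    by (metis div_mult_mod_eq)
  moreover have "i div b < a" "j div b < a" "i mod b < b" "j mod b < b"
    using ij \<open>0 < b\<close> by (simp_all add: less_mult_imp_div_less)
  ultimately show "kron (x \<cdot>\<^sub>m 1\<^sub>m a) (y \<cdot>\<^sub>m 1\<^sub>m b) $$ (i, j) = ((x * y) \<cdot>\<^sub>m 1\<^sub>m (a * b)) $$ (i, j)"
    using ij unfolding kron_def by auto
qed (simp_all add: kron_def)

lemma tensor_scaled_identity:
  "tensor m (\<lambda>k. c k \<cdot>\<^sub>m 1\<^sub>m (d k)) = (\<Prod>k\<in>{1..m}. c k) \<cdot>\<^sub>m 1\<^sub>m (tensor_dim m d)"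
proof -
  \<comment> \<open>\<open>foldr\<close> peels factors off the front, which changes the lower end of
    the index range; the induction therefore runs over arbitrary lists.\<close>
  have "foldr kron (map (\<lambda>k. c k \<cdot>\<^sub>m 1\<^sub>m (d k)) ks) (1\<^sub>m 1)
      = prod_list (map c ks) \<cdot>\<^sub>m 1\<^sub>m (prod_list (map d ks))" for ks
  proof (induction ks)
    case Nil
    then show ?case by (auto intro!: eq_matI)
  qed (simp add: kron_scaled_identity)
  then show ?thesis
    unfolding tensor_def tensor_dim_def
    using prod.distinct_set_conv_list[OF distinct_upt, of d 1 "Suc m"]
      prod.distinct_set_conv_list[OF distinct_upt, of c 1 "Suc m"]
    by (simp add: atLeastLessThanSuc_atLeastAtMost del: upt_Suc)
qed

text \<open>The identity is \<open>tensor_dim m d\<close> times the product of the maximally mixed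
  states, so one term suffices; positive dimensions give these states trace 1. It serves as a
  separable operator with positive trace against every state.\<close>

lemma one_mat_separable:
  assumes "\<forall>k\<in>{1..m}. 0 < d k"
  shows "1\<^sub>m (tensor_dim m d) \<in> SEP m d"
proof -
  let ?N = "tensor_dim m d"
  define \<sigma> where "\<sigma> k = complex_of_real (1 / real (d k)) \<cdot>\<^sub>m (1\<^sub>m (d k) :: complex mat)" for k
  have "0 < ?N" unfolding tensor_dim_def using assms by (simp add: prod_pos)
  have "tensor m \<sigma> = (\<Prod>k\<in>{1..m}. complex_of_real (1 / real (d k))) \<cdot>\<^sub>m 1\<^sub>m ?N"
    unfolding \<sigma>_def by (rule tensor_scaled_identity)
  also have "(\<Prod>k\<in>{1..m}. complex_of_real (1 / real (d k))) = 1 / of_nat ?N"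
    unfolding tensor_dim_def by (simp add: prod_dividef)
  finally have t: "tensor m \<sigma> = (1 / of_nat ?N) \<cdot>\<^sub>m 1\<^sub>m ?N" .
  have "\<sigma> k \<in> states (d k)" if "k \<in> {1..m}" for k
    unfolding states_def
  proof (intro CollectI conjI)
    show "\<sigma> k \<in> psd_ops (d k)" unfolding \<sigma>_def by (intro smult_psd one_mat_psd) simp
    show "mat_trace (\<sigma> k) = 1" using assms that unfolding \<sigma>_def mat_trace_def by auto
  qed
  moreover have "1\<^sub>m ?N = mat_sum ?N (\<lambda>l. complex_of_real (real ?N) \<cdot>\<^sub>m tensor m \<sigma>) {..<Suc 0}"
    using \<open>0 < ?N\<close> unfolding t mat_sum_def by (intro eq_matI) auto
  ultimately have "\<exists>L p s. (\<forall>l<L. 0 \<le> p l \<and> (\<forall>k\<in>{1..m}. s l k \<in> states (d k))) \<and>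
      1\<^sub>m ?N = mat_sum ?N (\<lambda>l. complex_of_real (p l) \<cdot>\<^sub>m tensor m (s l)) {..<L}"
    by (intro exI[of _ "Suc 0"] exI[of _ "\<lambda>_. real ?N"] exI[of _ "\<lambda>_. \<sigma>"]) simp
  then show ?thesis unfolding SEP_def using one_mat_psd by simp
qed

lemma SEP_psd: "F \<in> SEP m d \<Longrightarrow> F \<in> psd_ops (tensor_dim m d)"
  unfolding SEP_def mem_Collect_eq by (rule conjunct1)

lemma SEP_dual_iff:
  "E \<in> SEP_dual m d \<longleftrightarrow> E \<in> hermitian_ops (tensor_dim m d) \<and> (\<forall>F\<in>SEP m d. 0 \<le> Re (mat_trace (E * F)))"
proof -
  have "0 \<le> mat_trace (E * F) \<longleftrightarrow> 0 \<le> Re (mat_trace (E * F))"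
    if "E \<in> hermitian_ops (tensor_dim m d)" "F \<in> SEP m d" for F
    using mat_trace_hermitian_mult_real[OF that(1) psd_ops_hermitian[OF SEP_psd[OF that(2)]]]
    by (simp add: less_eq_complex_def)
  then show ?thesis unfolding SEP_dual_def by blast
qed

section \<open>Thresholds of operator pencils\<close>

text \<open>The threshold is the supremum of the ratios \<open>b x / a x\<close>.\<close>

lemma pencil_threshold:
  fixes a b :: "'x \<Rightarrow> real"
  assumes "\<And>x. x \<in> X \<Longrightarrow> 0 \<le> a x" and "x0 \<in> X" "0 < a x0"
    and bound: "\<And>x. x \<in> X \<Longrightarrow> b x \<le> q1 * a x"
  shows "\<exists>Q. \<forall>q. (\<forall>x\<in>X. b x \<le> q * a x) \<longleftrightarrow> Q \<le> q"
proof -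
  let ?S = "(\<lambda>x. b x / a x) ` {x \<in> X. 0 < a x}"
  have le: "(\<forall>x\<in>X. b x \<le> q * a x) \<longleftrightarrow> (\<forall>s\<in>?S. s \<le> q)" for q
  proof -
    \<comment> \<open>Where \<open>a x\<close> vanishes the condition does not depend on
      \<open>q\<close> and holds by \<open>bound\<close>; elsewhere it bounds the ratio.\<close>
    have "b x \<le> q * a x \<longleftrightarrow> (0 < a x \<longrightarrow> b x / a x \<le> q)" if "x \<in> X" for x
      using assms(1)[OF that] bound[OF that]
      by (cases "a x = 0") (auto simp: pos_divide_le_eq less_le)
    then show ?thesis by auto
  qed
  have "?S \<noteq> {}" using assms(2,3) by auto
  moreover have "bdd_above ?S" using le[of q1] bound by (auto simp: bdd_above_def)
  ultimately have "Sup ?S \<le> q \<longleftrightarrow> (\<forall>s\<in>?S. s \<le> q)" for q by (rule cSup_le_iff)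
  then show ?thesis using le by blast
qed

text \<open>The pairings of \<open>P\<close> and \<open>\<eta> R\<close> with separable operators
  play the roles of \<open>a\<close> and \<open>b\<close>. The identity supplies a positive
  \<open>a\<close>, and \<open>PR\<close> supplies the upper bound \<open>q1 = 1\<close>.\<close>

lemma block_positive_threshold:
  assumes "\<forall>k\<in>{1..m}. 0 < d k"
    and P: "P \<in> states (tensor_dim m d)" and R: "R \<in> hermitian_ops (tensor_dim m d)"
    and PR: "complex_of_real 1 \<cdot>\<^sub>m P - complex_of_real \<eta> \<cdot>\<^sub>m R \<in> psd_ops (tensor_dim m d)"
  obtains Q where "\<And>q. complex_of_real q \<cdot>\<^sub>m P - complex_of_real \<eta> \<cdot>\<^sub>m R \<in> SEP_dual m d \<longleftrightarrow> Q \<le> q"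
proof -
  let ?N = "tensor_dim m d"
  have P': "P \<in> psd_ops ?N" "P \<in> hermitian_ops ?N" "P \<in> carrier_mat ?N ?N" "mat_trace P = 1"
    using P unfolding states_def psd_ops_def hermitian_ops_def by auto
  have R': "R \<in> carrier_mat ?N ?N" using R unfolding hermitian_ops_def by auto
  have F: "F \<in> psd_ops ?N" "F \<in> carrier_mat ?N ?N" if "F \<in> SEP m d" for F
    using SEP_psd[OF that] psd_ops_iff by blast+
  have tr: "Re (mat_trace ((complex_of_real q \<cdot>\<^sub>m P - complex_of_real \<eta> \<cdot>\<^sub>m R) * F))
      = q * Re (mat_trace (P * F)) - \<eta> * Re (mat_trace (R * F))" if "F \<in> SEP m d" for q F
    unfolding mat_trace_scaled_diff_mult[OF P'(3) R' F(2)[OF that]] by simp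
  have "\<exists>Q. \<forall>q. (\<forall>F\<in>SEP m d. \<eta> * Re (mat_trace (R * F)) \<le> q * Re (mat_trace (P * F))) \<longleftrightarrow> Q \<le> q"
  proof (rule pencil_threshold)
    show "1\<^sub>m ?N \<in> SEP m d" using assms(1) by (rule one_mat_separable)
    show "0 < Re (mat_trace (P * 1\<^sub>m ?N))" using P' by simp
    show "0 \<le> Re (mat_trace (P * F))" if "F \<in> SEP m d" for F
      using mat_trace_psd_mult_nonneg[OF P'(1) F(1)[OF that]] .
    show "\<eta> * Re (mat_trace (R * F)) \<le> 1 * Re (mat_trace (P * F))" if "F \<in> SEP m d" for F
      using mat_trace_psd_mult_nonneg[OF PR F(1)[OF that]] unfolding tr[OF that] by simp
  qed
  then obtain Q where "\<And>q. (\<forall>F\<in>SEP m d. \<eta> * Re (mat_trace (R * F)) \<le> q * Re (mat_trace (P * F))) \<longleftrightarrow> Q \<le> q"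
    by blast
  then show ?thesis
    using that scaled_diff_hermitian[OF P'(2) R] tr unfolding SEP_dual_iff by simp
qed

text \<open>If the form \<open>Q P - \<eta> R\<close> vanished only where \<open>P\<close> does, it would dominate a positive multiple
  of \<open>P\<close>, so that \<open>Q\<close> could be decreased.\<close>

lemma psd_threshold_attained:
  assumes P: "P \<in> states N" and R: "R \<in> hermitian_ops N"
    and PR: "complex_of_real 1 \<cdot>\<^sub>m P - complex_of_real \<eta> \<cdot>\<^sub>m R \<in> psd_ops N"
  obtains Q v where "\<And>q. complex_of_real q \<cdot>\<^sub>m P - complex_of_real \<eta> \<cdot>\<^sub>m R \<in> psd_ops N \<longleftrightarrow> Q \<le> q"
    and "0 < hform N (entries P) v"
    and "\<eta> * hform N (entries R) v = Q * hform N (entries P) v"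
proof -
  let ?p = "hform N (entries P)" and ?r = "hform N (entries R)"
  have P': "P \<in> psd_ops N" "P \<in> hermitian_ops N" "P \<in> carrier_mat N N" "mat_trace P = 1"
    using P unfolding states_def psd_ops_def hermitian_ops_def by auto
  have p: "0 \<le> ?p v" for v using P'(1) unfolding psd_ops_iff by blast
  note psd_iff = scaled_diff_psd_iff[OF P'(2) R]
  \<comment> \<open>Trace 1 forces a positive diagonal entry, and the corresponding unit vector is a
    point where the form of \<open>P\<close> is positive.\<close>
  have "(\<Sum>k<N. Re (P $$ (k, k))) = 1"
    using P' unfolding mat_trace_def by (metis Re_sum carrier_matD(1) one_complex.simps(1))
  then have "\<exists>k<N. 0 < Re (P $$ (k, k))"
    using sum_nonpos[of "{..<N}" "\<lambda>k. Re (P $$ (k, k))"] by (force simp: not_less)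
  then obtain k where k: "k < N" "0 < Re (P $$ (k, k))" by blast
  have "\<exists>Q. \<forall>q. (\<forall>v\<in>UNIV. \<eta> * ?r v \<le> q * ?p v) \<longleftrightarrow> Q \<le> q"
  proof (rule pencil_threshold)
    show "0 < ?p (\<lambda>i. if i = k then 1 else 0)" using k by (simp add: hform_unit_vector)
    show "\<eta> * ?r v \<le> 1 * ?p v" for v using PR psd_iff by blast
  qed (use p in auto)
  then obtain Q where Q: "\<And>q. (\<forall>v. \<eta> * ?r v \<le> q * ?p v) \<longleftrightarrow> Q \<le> q" by auto
  have "\<exists>v. 0 < ?p v \<and> \<eta> * ?r v = Q * ?p v"
  proof (rule ccontr)
    assume no: "\<not> ?thesis"
    let ?T = "complex_of_real Q \<cdot>\<^sub>m P - complex_of_real \<eta> \<cdot>\<^sub>m R"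
    have T: "hform N (entries ?T) v = Q * ?p v - \<eta> * ?r v" for v
      unfolding hform_scaled_diff[symmetric] using P' R
      by (intro hform_cong) (auto simp: hermitian_ops_iff)
    have "?T \<in> psd_ops N" using Q[of Q] psd_iff by simp
    \<comment> \<open>A zero of the form of \<open>?T\<close> satisfies the desired equation, so by
      \<open>no\<close> the value \<open>?p v\<close> cannot be positive.\<close>
    moreover have "?p v = 0" if "hform N (entries ?T) v = 0" for v
      using no p[of v] that unfolding T by (metis diff_eq_eq add_0 less_le)
    ultimately obtain C where C: "0 < C" "\<And>v. ?p v \<le> C * hform N (entries ?T) v"
      using psd_form_dominated[of N "entries P" "entries ?T"] P'(1) unfolding psd_ops_iff by blast
    \<comment> \<open>Dividing the domination by \<open>C\<close> shows that the pencil at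
      \<open>Q - 1 / C\<close> is still positive, against the minimality of
      \<open>Q\<close>.\<close>
    have "\<eta> * ?r v \<le> (Q - 1 / C) * ?p v" for v
      using C(1) C(2)[of v] unfolding T by (simp add: field_simps)
    then have "Q \<le> Q - 1 / C" using Q[of "Q - 1 / C"] by simp
    then show False using C(1) by simp
  qed
  then show ?thesis using that Q psd_iff by auto
qed

section \<open>Projections as measurement effects\<close>

text \<open>Bessel's inequality for one unit vector: the residual \<open>v - c w\<close> has
  nonnegative squared norm.\<close>

lemma norm_projection_le:
  assumes "(\<Sum>i<N. (cmod (w i))\<^sup>2) = 1"
  shows "(cmod (\<Sum>j<N. cnj (w j) * v j))\<^sup>2 \<le> (\<Sum>i<N. (cmod (v i))\<^sup>2)"
proof -
  define c where "c = (\<Sum>j<N. cnj (w j) * v j)"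
  have cc: "cnj c = (\<Sum>j<N. w j * cnj (v j))" unfolding c_def by simp
  have w: "(\<Sum>i<N. w i * cnj (w i)) = 1"
    using assms by (simp flip: complex_norm_square of_real_power of_real_sum)
  have "complex_of_real (\<Sum>i<N. (cmod (v i - c * w i))\<^sup>2)
      = (\<Sum>i<N. v i * cnj (v i) - cnj c * (cnj (w i) * v i) - c * (w i * cnj (v i))
          + c * cnj c * (w i * cnj (w i)))"
    unfolding of_real_sum complex_norm_square by (intro sum.cong refl) (simp add: algebra_simps)
  also have "\<dots> = (\<Sum>i<N. v i * cnj (v i)) - cnj c * c - c * cnj c + c * cnj c"
    by (simp add: sum.distrib sum_subtractf sum_distrib_left[symmetric] w cc[symmetric] c_def[symmetric])
  also have "\<dots> = complex_of_real ((\<Sum>i<N. (cmod (v i))\<^sup>2) - (cmod c)\<^sup>2)"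
    unfolding of_real_diff of_real_sum complex_norm_square by simp
  finally have "(\<Sum>i<N. (cmod (v i - c * w i))\<^sup>2) = (\<Sum>i<N. (cmod (v i))\<^sup>2) - (cmod c)\<^sup>2"
    using of_real_eq_iff by blast
  moreover have "0 \<le> (\<Sum>i<N. (cmod (v i - c * w i))\<^sup>2)" by (intro sum_nonneg) simp
  ultimately show ?thesis unfolding c_def by simp
qed

text \<open>\<open>E\<close> is the orthogonal projection onto the line of \<open>w\<close>, so
  positivity of its complement is Bessel's inequality.\<close>

lemma unit_projection_effect:
  assumes "(\<Sum>i<N. (cmod (w i))\<^sup>2) = 1"
  defines "E \<equiv> mat N N (\<lambda>(i, j). w i * cnj (w j))"
  shows "E \<in> psd_ops N" and "1\<^sub>m N - E \<in> psd_ops N"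
proof -
  have E: "hform N (entries E) v = (cmod (\<Sum>j<N. cnj (w j) * v j))\<^sup>2" for v
    unfolding hform_rank_one[symmetric] E_def by (intro hform_cong) simp
  then show psd: "E \<in> psd_ops N"
    unfolding psd_ops_iff by (auto intro!: hermitian_coeffsI simp: E_def)
  have one: "hform N (entries (1\<^sub>m N)) v = 1 * (\<Sum>i<N. (cmod (v i))\<^sup>2)" for v
    unfolding hform_diagonal[symmetric] by (intro hform_cong) simp
  have "complex_of_real 1 \<cdot>\<^sub>m 1\<^sub>m N - complex_of_real 1 \<cdot>\<^sub>m E \<in> psd_ops N"
    using norm_projection_le[OF assms(1)] one_mat_psd psd
    by (subst scaled_diff_psd_iff) (auto simp: psd_ops_def one E)
  moreover have "complex_of_real 1 \<cdot>\<^sub>m 1\<^sub>m N - complex_of_real 1 \<cdot>\<^sub>m E = 1\<^sub>m N - E"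
    by (intro eq_matI) (auto simp: E_def)
  ultimately show "1\<^sub>m N - E \<in> psd_ops N" by simp
qed

text \<open>Outcome 0 takes the remainder \<open>1 - E\<close>; it differs from \<open>j\<close>
  because \<open>j\<close> is at least 1.\<close>

lemma measurement_with_effect:
  assumes "E \<in> psd_ops N" "1\<^sub>m N - E \<in> psd_ops N" "j \<in> {1..n}"
  obtains M where "measurement N n M" "M j = E"
proof
  \<comment> \<open>All other outcomes are zero, written as a multiple of \<open>E\<close> to have
    the right dimension.\<close>
  let ?M = "\<lambda>i. if i = j then E else if i = 0 then 1\<^sub>m N - E else complex_of_real 0 \<cdot>\<^sub>m E"
  have E: "E \<in> carrier_mat N N" using assms(1) unfolding psd_ops_iff by blast
  have "(\<Sum>i\<in>{0..n}. ?M i $$ (r, c)) = 1\<^sub>m N $$ (r, c)" if "r < N" "c < N" for r c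
  proof -
    have "(\<Sum>i\<in>{0..n}. ?M i $$ (r, c))
        = (\<Sum>i\<in>{0..n}. (if i = j then E $$ (r, c) else 0) + (if i = 0 then (1\<^sub>m N - E) $$ (r, c) else 0))"
      using assms(3) that E by (intro sum.cong refl) auto
    also have "\<dots> = E $$ (r, c) + (1\<^sub>m N - E) $$ (r, c)"
      using assms(3) by (simp add: sum.distrib)
    finally show ?thesis using that E by simp
  qed
  then have "mat_sum N ?M {0..n} = 1\<^sub>m N"
    unfolding mat_sum_def by (intro eq_matI) auto
  then show "measurement N n ?M"
    unfolding measurement_def using assms smult_psd[OF assms(1), of 0] by auto
  show "?M j = E" by simp
qed

section \<open>The average state of an ensemble\<close>

lemma avg_state_index:
  assumes "\<And>i. i \<in> {1..n} \<Longrightarrow> \<rho> i \<in> carrier_mat N N" "r < N" "c < N"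
  shows "avg_state N n \<eta> \<rho> $$ (r, c) = (\<Sum>i\<in>{1..n}. complex_of_real (\<eta> i) * \<rho> i $$ (r, c))"
proof -
  have "(complex_of_real (\<eta> i) \<cdot>\<^sub>m \<rho> i) $$ (r, c) = complex_of_real (\<eta> i) * \<rho> i $$ (r, c)"
    if "i \<in> {1..n}" for i
    using assms(1)[OF that] assms(2,3) by auto
  then show ?thesis using assms(2,3) unfolding avg_state_def mat_sum_def by simp
qed

lemma hform_avg_state:
  assumes "\<And>i. i \<in> {1..n} \<Longrightarrow> \<rho> i \<in> carrier_mat N N"
  shows "hform N (entries (avg_state N n \<eta> \<rho>)) v = (\<Sum>i\<in>{1..n}. \<eta> i * hform N (entries (\<rho> i)) v)"
  unfolding hform_scaled_sum[symmetric] by (intro hform_cong avg_state_index assms)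

lemma ensembleD:
  assumes "ensemble N n \<eta> \<rho>" "i \<in> {1..n}"
  shows "0 < \<eta> i" "\<rho> i \<in> psd_ops N" "\<rho> i \<in> carrier_mat N N" "mat_trace (\<rho> i) = 1"
    "0 \<le> hform N (entries (\<rho> i)) v"
proof -
  show *: "0 < \<eta> i" "\<rho> i \<in> psd_ops N" "mat_trace (\<rho> i) = 1"
    using assms unfolding ensemble_def states_def by blast+
  then show "\<rho> i \<in> carrier_mat N N" "0 \<le> hform N (entries (\<rho> i)) v"
    unfolding psd_ops_iff by blast+
qed

lemma avg_state_is_state:
  assumes "ensemble N n \<eta> \<rho>"
  shows "avg_state N n \<eta> \<rho> \<in> states N"
proof -
  let ?P = "avg_state N n \<eta> \<rho>"
  note E = ensembleD[OF assms]
  have entry: "?P $$ (r, c) = (\<Sum>i\<in>{1..n}. complex_of_real (\<eta> i) * \<rho> i $$ (r, c))"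
    if "r < N" "c < N" for r c
    using E(3) that by (rule avg_state_index)
  have form: "hform N (entries ?P) v = (\<Sum>i\<in>{1..n}. \<eta> i * hform N (entries (\<rho> i)) v)" for v
    using E(3) by (rule hform_avg_state)
  have car: "?P \<in> carrier_mat N N" unfolding avg_state_def mat_sum_def by simp
  have "hermitian_coeffs N (entries ?P)"
  proof (rule hermitian_coeffsI)
    fix r c assume rc: "r < N" "c < N"
    have "cnj (\<rho> i $$ (r, c)) = \<rho> i $$ (c, r)" if "i \<in> {1..n}" for i
      using E(2)[OF that] hermitian_coeffsD[OF _ rc, of "entries (\<rho> i)"] unfolding psd_ops_iff by blast
    then show "?P $$ (c, r) = cnj (?P $$ (r, c))"
      using rc by (simp add: entry)
  qed
  moreover have "0 \<le> hform N (entries ?P) v" for v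
    unfolding form by (intro sum_nonneg mult_nonneg_nonneg E(5) less_imp_le[OF E(1)])
  ultimately have psd: "?P \<in> psd_ops N" using car unfolding psd_ops_iff by blast
  have "mat_trace ?P = (\<Sum>k<N. \<Sum>i\<in>{1..n}. complex_of_real (\<eta> i) * \<rho> i $$ (k, k))"
    using car by (simp add: mat_trace_def entry)
  also have "\<dots> = (\<Sum>i\<in>{1..n}. complex_of_real (\<eta> i) * (\<Sum>k<N. \<rho> i $$ (k, k)))"
    unfolding sum_distrib_left by (rule sum.swap)
  also have "\<dots> = (\<Sum>i\<in>{1..n}. complex_of_real (\<eta> i))"
  proof (intro sum.cong refl)
    fix i assume i: "i \<in> {1..n}"
    then have "(\<Sum>k<N. \<rho> i $$ (k, k)) = 1"
      using E(3)[OF i] E(4)[OF i] unfolding mat_trace_def by auto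
    then show "complex_of_real (\<eta> i) * (\<Sum>k<N. \<rho> i $$ (k, k)) = complex_of_real (\<eta> i)" by simp
  qed
  also have "\<dots> = complex_of_real (\<Sum>i\<in>{1..n}. \<eta> i)" by (rule of_real_sum[symmetric])
  also have "\<dots> = 1" using assms unfolding ensemble_def by simp
  finally show ?thesis using psd unfolding states_def by blast
qed

text \<open>What remains is the sum of the other weighted states. This places \<open>q = 1\<close>
  in both half lines.\<close>

lemma avg_state_minus_component_psd:
  assumes "ensemble N n \<eta> \<rho>" "j \<in> {1..n}"
  shows "complex_of_real 1 \<cdot>\<^sub>m avg_state N n \<eta> \<rho> - complex_of_real (\<eta> j) \<cdot>\<^sub>m \<rho> j \<in> psd_ops N"
proof -
  note E = ensembleD[OF assms(1)]
  have P: "avg_state N n \<eta> \<rho> \<in> hermitian_ops N"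
    using avg_state_is_state[OF assms(1)] psd_ops_hermitian unfolding states_def by blast
  have "\<eta> j * hform N (entries (\<rho> j)) v \<le> 1 * hform N (entries (avg_state N n \<eta> \<rho>)) v" for v
  proof -
    have "\<eta> j * hform N (entries (\<rho> j)) v \<le> (\<Sum>i\<in>{1..n}. \<eta> i * hform N (entries (\<rho> i)) v)"
      using assms(2)
      by (intro member_le_sum mult_nonneg_nonneg E(5) less_imp_le[OF E(1)]) auto
    moreover have "hform N (entries (avg_state N n \<eta> \<rho>)) v = (\<Sum>i\<in>{1..n}. \<eta> i * hform N (entries (\<rho> i)) v)"
      using E(3) by (rule hform_avg_state)
    ultimately show ?thesis by simp
  qed
  then show ?thesis unfolding scaled_diff_psd_iff[OF P psd_ops_hermitian[OF E(2)[OF assms(2)]]] by blast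
qed

section \<open>The maximum confidence as a threshold\<close>

text \<open>An optimal effect is the projection onto the vector at which the threshold is attained.\<close>

lemma max_confidence_eq:
  assumes ens: "ensemble N n \<eta> \<rho>" and j: "j \<in> {1..n}"
    and C: "\<And>q. complex_of_real q \<cdot>\<^sub>m avg_state N n \<eta> \<rho> - complex_of_real (\<eta> j) \<cdot>\<^sub>m \<rho> j \<in> psd_ops N \<longleftrightarrow> C \<le> q"
    and pos: "0 < hform N (entries (avg_state N n \<eta> \<rho>)) v"
    and eq: "\<eta> j * hform N (entries (\<rho> j)) v = C * hform N (entries (avg_state N n \<eta> \<rho>)) v"
  shows "max_confidence N n \<eta> \<rho> j = C"
proof -
  let ?P = "avg_state N n \<eta> \<rho>"
  have P: "?P \<in> psd_ops N" "?P \<in> carrier_mat N N"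
    using avg_state_is_state[OF ens] psd_ops_iff unfolding states_def by blast+
  note R = ensembleD(2,3)[OF ens j]
  define s where "s = (\<Sum>i<N. (cmod (v i))\<^sup>2)"
  have "s \<noteq> 0"
  proof
    assume "s = 0"
    then have "v i = 0" if "i < N" for i
      using that sum_nonneg_eq_0_iff[of "{..<N}" "\<lambda>i. (cmod (v i))\<^sup>2"] unfolding s_def by simp
    then have "hform N (entries ?P) v = 0" unfolding hform_def by simp
    then show False using pos by simp
  qed
  moreover have "0 \<le> s" unfolding s_def by (intro sum_nonneg) simp
  ultimately have s: "0 < s" by simp
  define w where "w = (\<lambda>i. complex_of_real (1 / sqrt s) * v i)"
  have "(\<Sum>i<N. (cmod (w i))\<^sup>2) = (\<Sum>i<N. (cmod (v i))\<^sup>2 / s)"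
    using s unfolding w_def by (intro sum.cong refl) (simp add: norm_mult norm_divide power_divide power_mult_distrib)
  then have w: "(\<Sum>i<N. (cmod (w i))\<^sup>2) = 1"
    using s by (simp add: sum_divide_distrib[symmetric] s_def[symmetric])
  define E where "E = mat N N (\<lambda>(i, j). w i * cnj (w j))"
  obtain M where M: "measurement N n M" "M j = E"
    using measurement_with_effect[OF unit_projection_effect[OF w] j] unfolding E_def .
  \<comment> \<open>Normalising \<open>v\<close> divides all these traces by the same
    \<open>s\<close>, so the confidence of \<open>E\<close> is the ratio of the forms at
    \<open>v\<close>.\<close>
  have tr: "Re (mat_trace (A * E)) = hform N (entries A) v / s" if "A \<in> carrier_mat N N" for A
  proof -
    have "Re (mat_trace (A * E)) = (\<Sum>u\<leftarrow>[w]. hform N (entries A) u)"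
      using that by (intro mat_trace_mult_rank_one_sum) (simp_all add: E_def)
    also have "\<dots> = hform N (entries A) v / s"
      using s unfolding w_def by (simp only: list.map sum_list_simps hform_scale_vector) (simp add: power_divide)
    finally show ?thesis .
  qed
  show ?thesis
    unfolding max_confidence_def
  proof (rule Greatest_equality)
    have "\<eta> j * Re (mat_trace (\<rho> j * M j)) / Re (mat_trace (?P * M j)) = C"
      using pos s eq unfolding M(2) tr[OF P(2)] tr[OF R(2)] by (simp add: field_simps)
    moreover have "mat_trace (?P * M j) \<noteq> 0"
      using tr[OF P(2)] pos s unfolding M(2) by auto
    ultimately show "\<exists>M. measurement N n M \<and> mat_trace (?P * M j) \<noteq> 0 \<and>
        C = \<eta> j * Re (mat_trace (\<rho> j * M j)) / Re (mat_trace (?P * M j))"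
      using M(1) by blast
  next
    fix c assume "\<exists>M. measurement N n M \<and> mat_trace (?P * M j) \<noteq> 0 \<and>
        c = \<eta> j * Re (mat_trace (\<rho> j * M j)) / Re (mat_trace (?P * M j))"
    then obtain M where M: "measurement N n M" "mat_trace (?P * M j) \<noteq> 0"
      and c: "c = \<eta> j * Re (mat_trace (\<rho> j * M j)) / Re (mat_trace (?P * M j))" by blast
    have Mj: "M j \<in> psd_ops N" using M(1) j unfolding measurement_def by auto
    then have Mc: "M j \<in> carrier_mat N N" unfolding psd_ops_iff by blast
    have "Im (mat_trace (?P * M j)) = 0"
      using mat_trace_hermitian_mult_real[OF psd_ops_hermitian[OF P(1)] psd_ops_hermitian[OF Mj]] .
    \<comment> \<open>The trace is real and nonnegative, so being nonzero makes its real part a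
      positive denominator.\<close>
    then have "Re (mat_trace (?P * M j)) \<noteq> 0" using M(2) by (simp add: complex_eq_iff)
    then have p: "0 < Re (mat_trace (?P * M j))" using mat_trace_psd_mult_nonneg[OF P(1) Mj] by simp
    \<comment> \<open>Pairing the positive pencil at \<open>C\<close> with the effect bounds the
      numerator by \<open>C\<close> times the denominator.\<close>
    have "complex_of_real C \<cdot>\<^sub>m ?P - complex_of_real (\<eta> j) \<cdot>\<^sub>m \<rho> j \<in> psd_ops N" using C by simp
    from mat_trace_psd_mult_nonneg[OF this Mj]
    have "\<eta> j * Re (mat_trace (\<rho> j * M j)) \<le> C * Re (mat_trace (?P * M j))"
      unfolding mat_trace_scaled_diff_mult[OF P(2) R(2) Mc] by simp
    then show "c \<le> C" unfolding c using p by (simp add: pos_divide_le_eq)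
  qed
qed

theorem theorem4:
  fixes m n j :: nat and d :: "nat \<Rightarrow> nat"
    and \<eta> :: "nat \<Rightarrow> real" and \<rho> :: "nat \<Rightarrow> complex mat" and q :: real
  assumes "m \<ge> 2" and "\<forall>k\<in>{1..m}. d k > 0"
    and "ensemble (tensor_dim m d) n \<eta> \<rho>"
    and "j \<in> {1..n}"
  shows "Q_min m d n \<eta> \<rho> j \<le> q \<and> q < max_confidence (tensor_dim m d) n \<eta> \<rho> j
    \<longleftrightarrow> entanglement_witness m d
          (complex_of_real q \<cdot>\<^sub>m avg_state (tensor_dim m d) n \<eta> \<rho>
            - complex_of_real (\<eta> j) \<cdot>\<^sub>m \<rho> j)"
proof -
  let ?N = "tensor_dim m d"
  let ?G = "\<lambda>q. complex_of_real q \<cdot>\<^sub>m avg_state ?N n \<eta> \<rho> - complex_of_real (\<eta> j) \<cdot>\<^sub>m \<rho> j"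
  note P = avg_state_is_state[OF assms(3)]
  note R = psd_ops_hermitian[OF ensembleD(2)[OF assms(3,4)]]
  note PR = avg_state_minus_component_psd[OF assms(3,4)]
  obtain Q where Q: "\<And>q. ?G q \<in> SEP_dual m d \<longleftrightarrow> Q \<le> q"
    using block_positive_threshold[OF assms(2) P R PR] by blast
  obtain C v where C: "\<And>q. ?G q \<in> psd_ops ?N \<longleftrightarrow> C \<le> q"
    and v: "0 < hform ?N (entries (avg_state ?N n \<eta> \<rho>)) v"
      "\<eta> j * hform ?N (entries (\<rho> j)) v = C * hform ?N (entries (avg_state ?N n \<eta> \<rho>)) v"
    using psd_threshold_attained[OF P R PR] by blast
  \<comment> \<open>The defining set is the closed half line from \<open>Q\<close> upwards, so
    \<open>LEAST\<close> is attained there.\<close>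
  have "Q_min m d n \<eta> \<rho> j = Q"
    unfolding Q_min_def by (rule Least_equality) (simp_all add: Q)
  moreover have "max_confidence ?N n \<eta> \<rho> j = C"
    using max_confidence_eq[OF assms(3,4) C v] .
  ultimately show ?thesis unfolding entanglement_witness_def Diff_iff Q C by (simp add: not_le)
qed

end
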